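(* For any finite, simple, connected graph $G$, $c_{cr}(G)\geq c(G)$.
   Context: Cops and Robbers on $G$ with $k$ cops: the cops are placed on vertices, then the robber is placed on a vertex; thereafter the players alternate, each cop moving to a vertex in its closed neighbourhood on the cops' turn, and the robber moving to a vertex in his closed neighbourhood on his turn, with perfect information. The robber is caught if at any point in the game a cop and the robber are on the same vertex. $c(G)$ is the least number of cops that have a strategy guaranteeing capture of the robber on $G$. Cheating Robot game on a finite, simple, connected graph $G$ with $k$ cops: first the cop player places $k$ cops on vertices of $G$, then the robot is placed on a vertex. A vertex may hold more than one token. Play then proceeds in rounds: in each round, first every cop moves to a vertex in its closed neighbourhood (so a cop may stay put), and then the robot, knowing the cops' moves, moves to a vertex in his closed neighbourhood (he may stay put). Both sides have perfect information about positions. The robot is captured if either (i) at the end of the robot's move a cop and the robot are on the same vertex, or (ii) on his move the robot traverses an edge that a cop traversed on the cops' immediately preceding move. (A cop moving onto the robot's vertex does not by itself end the game; the robot still gets his move.) The cops win if they capture the robot after finitely many rounds. $c_{cr}(G)$ is the least number of cops that have a strategy guaranteeing capture of the robot on $G$. *)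

theory Defs
  imports "Graph_Theory.Digraph_Component"
begin

text \<open>
  Finite simple graphs are the finite symmetric digraphs without loops and parallel arcs of
  the locale \<open>graph\<close>; a pair of opposite arcs represents one edge. Note that \<open>connected G\<close>
  includes \<open>verts G \<noteq> {}\<close>.
\<close>

definition closed_nbhd :: "('a, 'b) pre_digraph \<Rightarrow> 'a \<Rightarrow> 'a set" where
  "closed_nbhd G u = {v \<in> verts G. v = u \<or> u \<rightarrow>\<^bsub>G\<^esub> v}"

text \<open>
  Time \<open>0\<close> is the placement. In round \<open>n + 1\<close> the cops move from their time-\<open>n\<close> to their
  time-\<open>(n + 1)\<close> positions, and then the evader (robber or robot) moves from \<open>r n\<close> to
  \<open>r (Suc n)\<close>. The game rules for moving are the same in both games; only the capture
  conditions differ. An evader's play is not cut off at capture: what happens afterwards is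
  irrelevant, and legal moves always exist since tokens may stay put.
\<close>

definition evader_play :: "('a, 'b) pre_digraph \<Rightarrow> (nat \<Rightarrow> 'a) \<Rightarrow> bool" where
  "evader_play G r \<longleftrightarrow> r 0 \<in> verts G \<and> (\<forall>n. r (Suc n) \<in> closed_nbhd G (r n))"

text \<open>
  A strategy maps the list of all evader positions seen so far to the list of the next cop
  positions (entry \<open>i\<close> belongs to cop \<open>i\<close>); on the empty list it gives the initial placement.
  The cops' own earlier positions need not be part of the input, as they are determined by
  the strategy and the earlier evader positions.
\<close>

type_synonym 'a strategy = "'a list \<Rightarrow> 'a list"

definition cops_at :: "'a strategy \<Rightarrow> (nat \<Rightarrow> 'a) \<Rightarrow> nat \<Rightarrow> 'a list" where
  "cops_at \<sigma> r n = \<sigma> (map r [0..<n])"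

definition cop_strategy :: "('a, 'b) pre_digraph \<Rightarrow> nat \<Rightarrow> 'a strategy \<Rightarrow> bool" where
  "cop_strategy G k \<sigma> \<longleftrightarrow>
     (\<forall>r. evader_play G r \<longrightarrow>
        (\<forall>n. length (cops_at \<sigma> r n) = k) \<and>
        set (cops_at \<sigma> r 0) \<subseteq> verts G \<and>
        (\<forall>n. \<forall>i<k. cops_at \<sigma> r (Suc n) ! i \<in> closed_nbhd G (cops_at \<sigma> r n ! i)))"

text \<open>
  Cops and Robbers: capture at any point, i.e. right after the robber's placement or move
  (first disjunct) or right after the cops' move (second disjunct).
\<close>

definition robber_caught :: "nat \<Rightarrow> 'a strategy \<Rightarrow> (nat \<Rightarrow> 'a) \<Rightarrow> bool" where
  "robber_caught k \<sigma> r \<longleftrightarrow>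
     (\<exists>n. \<exists>i<k. cops_at \<sigma> r n ! i = r n \<or> cops_at \<sigma> r (Suc n) ! i = r n)"

text \<open>
  Cheating Robot: capture in round \<open>n + 1\<close>, at the end of the robot's move (first disjunct) or
  by traversing, in either direction, an edge just traversed by a cop (second disjunct).
\<close>

definition robot_captured :: "nat \<Rightarrow> 'a strategy \<Rightarrow> (nat \<Rightarrow> 'a) \<Rightarrow> bool" where
  "robot_captured k \<sigma> r \<longleftrightarrow>
     (\<exists>n. \<exists>i<k. cops_at \<sigma> r (Suc n) ! i = r (Suc n) \<or>
        (r (Suc n) \<noteq> r n \<and>
         {cops_at \<sigma> r n ! i, cops_at \<sigma> r (Suc n) ! i} = {r n, r (Suc n)}))"

definition cops_win_robber :: "('a, 'b) pre_digraph \<Rightarrow> nat \<Rightarrow> bool" where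
  "cops_win_robber G k \<longleftrightarrow>
     (\<exists>\<sigma>. cop_strategy G k \<sigma> \<and> (\<forall>r. evader_play G r \<longrightarrow> robber_caught k \<sigma> r))"

definition cops_win_robot :: "('a, 'b) pre_digraph \<Rightarrow> nat \<Rightarrow> bool" where
  "cops_win_robot G k \<longleftrightarrow>
     (\<exists>\<sigma>. cop_strategy G k \<sigma> \<and> (\<forall>r. evader_play G r \<longrightarrow> robot_captured k \<sigma> r))"

text \<open>
  Both minima exist for finite graphs (lemma \<open>cops_win_card\<close> below).
\<close>

definition cop_number :: "('a, 'b) pre_digraph \<Rightarrow> nat" where
  "cop_number G = (LEAST k. cops_win_robber G k)"

definition cheating_robot_number :: "('a, 'b) pre_digraph \<Rightarrow> nat" where
  "cheating_robot_number G = (LEAST k. cops_win_robot G k)"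

lemma evader_play_in_verts: "evader_play G r \<Longrightarrow> r n \<in> verts G"
  by (cases n) (auto simp: evader_play_def closed_nbhd_def)

lemma cops_win_card:
  assumes "finite (verts G)"
  shows "cops_win_robber G (card (verts G))" "cops_win_robot G (card (verts G))"
proof -
  obtain xs where xs: "set xs = verts G" "distinct xs"
    using finite_distinct_list[OF assms] by blast
  have len: "length xs = card (verts G)"
    using distinct_card[OF xs(2)] xs(1) by simp
  define \<sigma> :: "'a strategy" where "\<sigma> = (\<lambda>_. xs)"
  have c: "cops_at \<sigma> r n = xs" for r n
    by (simp add: cops_at_def \<sigma>_def)
  have strat: "cop_strategy G (card (verts G)) \<sigma>"
  proof -
    have "xs ! i \<in> verts G" if "i < card (verts G)" for i
      using nth_mem[of i xs] that by (simp add: xs(1) len)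
    then show ?thesis
      by (simp add: cop_strategy_def c len closed_nbhd_def xs(1))
  qed
  have hit: "\<exists>i<card (verts G). xs ! i = r n" if "evader_play G r" for r n
    using evader_play_in_verts[OF that, of n] unfolding xs(1)[symmetric] in_set_conv_nth len[unfolded xs(1)[symmetric], symmetric] .
  show "cops_win_robber G (card (verts G))"
    unfolding cops_win_robber_def robber_caught_def
    by (rule exI[of _ \<sigma>]) (use strat hit in \<open>simp add: c\<close>)
  show "cops_win_robot G (card (verts G))"
    unfolding cops_win_robot_def robot_captured_def
    by (rule exI[of _ \<sigma>]) (use strat hit[of _ "Suc 0"] in \<open>simp add: c; blast\<close>)
qed

end

theory Submission
  imports Defs
begin

text \<open>
  Every winning strategy against the robot also wins against the robber: suppose that a cop
  captures the robot by traversing the same edge. If the two move in the same direction, they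
  already share a vertex before the round; if they move in opposite directions, the cop lands
  on the evader's vertex before the evader moves. Either way the robber is caught.
\<close>

lemma robot_captured_imp_robber_caught:
  assumes "robot_captured k \<sigma> r"
  shows "robber_caught k \<sigma> r"
proof -
  obtain n i where i: "i < k"
    and "cops_at \<sigma> r (Suc n) ! i = r (Suc n) \<or>
      {cops_at \<sigma> r n ! i, cops_at \<sigma> r (Suc n) ! i} = {r n, r (Suc n)}"
    using assms unfolding robot_captured_def by blast
  then consider "cops_at \<sigma> r (Suc n) ! i = r (Suc n)"
    | "cops_at \<sigma> r n ! i = r n" | "cops_at \<sigma> r (Suc n) ! i = r n"
    by (auto simp: doubleton_eq_iff)
  then show ?thesis
    using i unfolding robber_caught_def by cases blast+
qed

lemma cops_win_robot_imp_cops_win_robber: "cops_win_robot G k \<Longrightarrow> cops_win_robber G k"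
  unfolding cops_win_robot_def cops_win_robber_def
  using robot_captured_imp_robber_caught by blast

theorem theorem2p1:
  fixes G :: "('a, 'b) pre_digraph"
  assumes "graph G" and "connected G"
  shows "cheating_robot_number G \<ge> cop_number G"
proof -
  interpret graph G by fact
  have "cops_win_robot G (cheating_robot_number G)"
    unfolding cheating_robot_number_def
    using cops_win_card(2)[OF finite_verts] by (rule LeastI)
  then show ?thesis
    unfolding cop_number_def by (intro Least_le cops_win_robot_imp_cops_win_robber)
qed

end
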